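(* Let $w:(-\infty,0)\to\mathbb R$ be such that the function $p\mapsto w(-p)$, $p>0$, is the Laplace transform of a nonnegative nondecreasing original, and let $\psi\in\mathcal T_1$ satisfy $\psi'(-\infty)=0$. Then the function $$\varphi(s)=\int_s^0\psi(t)w(t)\,dt,\qquad s<0,$$ also belongs to $\mathcal T_1$ (provided that the integral exists, i.e. is finite for all $s<0$).
   Context: A function in $C^\infty((-\infty,0))$ is called absolutely monotone if it is nonnegative together with all its derivatives. $\mathcal T_1$ is the class of all nonpositive functions in $C^\infty((-\infty,0))$ whose first derivative is absolutely monotone. $\psi'(-\infty)=\lim_{s\to-\infty}\psi'(s)$. The hypothesis on $w$ means: there is a nonnegative nondecreasing function $f$ on $[0,\infty)$ (extended by $f(r)=0$ for $r<0$) such that $w(-p)=(\mathcal Lf)(p)=\int_0^\infty e^{-pr}f(r)\,dr$, with convergent integral, for all $p>0$; equivalently $w(s)=\int_0^\infty e^{rs}f(r)\,dr$ for $s<0$. *)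

theory Defs
  imports "HOL-Analysis.Analysis"
begin

(* Functions on the open half-line (-\<infinity>, 0) are represented by total functions on the reals.
   Since the half-line is open, derivatives at its points, and hence all the notions below,
   depend only on the values of the function at negative arguments. *)

definition smooth_neg :: "(real \<Rightarrow> real) \<Rightarrow> bool" where
  "smooth_neg f \<longleftrightarrow> (\<forall>n. \<forall>s<0. (deriv ^^ n) f field_differentiable at s)"

definition absolutely_monotone :: "(real \<Rightarrow> real) \<Rightarrow> bool" where
  "absolutely_monotone f \<longleftrightarrow> smooth_neg f \<and> (\<forall>n. \<forall>s<0. 0 \<le> (deriv ^^ n) f s)"

definition class_T1 :: "(real \<Rightarrow> real) set" where
  "class_T1 = {\<psi>. smooth_neg \<psi> \<and> (\<forall>s<0. \<psi> s \<le> 0) \<and> absolutely_monotone (deriv \<psi>)}"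

definition has_laplace_transform :: "(real \<Rightarrow> real) \<Rightarrow> (real \<Rightarrow> real) \<Rightarrow> bool" where
  "has_laplace_transform f F \<longleftrightarrow>
     (\<forall>p>0. set_integrable lborel {0..} (\<lambda>r. exp (- p * r) * f r) \<and>
            F p = (LINT r:{0..}|lborel. exp (- p * r) * f r))"

definition nonneg_nondecreasing_original :: "(real \<Rightarrow> real) \<Rightarrow> bool" where
  "nonneg_nondecreasing_original f \<longleftrightarrow>
     (\<forall>r<0. f r = 0) \<and> (\<forall>r\<ge>0. 0 \<le> f r) \<and> mono_on {0..} f"

end

theory Submission
  imports Defs "HOL-Real_Asymp.Real_Asymp"
begin

text \<open>
  By the fundamental theorem of calculus \<open>\<phi>' = - \<psi> w\<close> on the negative half-line, so everything
  rests on the absolute monotonicity of \<open>- \<psi> w\<close>, which comes from the factorization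
  \<open>- \<psi>(s) w(s) = (\<psi>(s) / s) \<cdot> (- s w(s))\<close>. Both factors are absolutely monotone, hence so is their
  product, by the Leibniz formula.

  For \<open>\<psi>(s) / s\<close> (\<open>absolutely_monotone_div_id\<close>): its \<open>n\<close>-th derivative is
  \<open>- n! T\<^sub>n(s) / (-s)\<^sup>n\<^sup>+\<^sup>1\<close>, where \<open>T\<^sub>n(s)\<close> is the Taylor polynomial of \<open>\<psi>\<close> of degree \<open>n\<close> centred
  at \<open>s\<close>, evaluated at \<open>0\<close>. Since \<open>\<psi>\<close> is nonpositive and the Lagrange remainder, a derivative
  of positive order, is nonnegative, \<open>T\<^sub>n(s) \<le> 0\<close>.

  For \<open>- s w(s)\<close> (\<open>absolutely_monotone_id_times_laplace\<close>): its \<open>n\<close>-th derivative is the integral of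
  the original \<open>f\<close> against the kernel \<open>- d/dr (r\<^sup>n e\<^sup>s\<^sup>r)\<close>. This kernel is at most \<open>0\<close> before
  \<open>r\<^sub>0 = n / (-s)\<close> and at least \<open>0\<close> after it, and its integral is nonnegative. Since \<open>f\<close> is
  nondecreasing, replacing it by the constant \<open>f(r\<^sub>0) \<ge> 0\<close> can only decrease the integral, so the
  integral is nonnegative (\<open>kernel_integral_nonneg\<close>).

  The argument works with the derivatives directly, so Bernstein's representation of absolutely
  monotone functions as Laplace integrals does not enter.
\<close>

section \<open>Absolutely monotone functions\<close>

text \<open>The iterated operator \<open>deriv\<close> is awkward to compute with. An explicit candidate sequence
  \<open>D\<close> of derivatives is enough, and agreement on the open half-line suffices to transfer it.\<close>

lemma higher_deriv_neg_eqI: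
  assumes eq: "\<And>s. s < 0 \<Longrightarrow> F s = D 0 s"
    and der: "\<And>n s. s < 0 \<Longrightarrow> (D n has_real_derivative D (Suc n) s) (at s)"
    and s: "s < 0"
  shows "(deriv ^^ n) F s = D n s"
    and "((deriv ^^ n) F has_real_derivative D (Suc n) s) (at s)"
proof -
  have transfer: "(G has_real_derivative D (Suc n) s) (at s)"
    if "\<And>t. t < 0 \<Longrightarrow> G t = D n t" "s < 0" for G n s
    by (rule has_field_derivative_transform_within_open[OF der, where S = "{..<0}"])
       (use that in auto)
  have val: "\<And>s. s < 0 \<Longrightarrow> (deriv ^^ n) F s = D n s" for n
  proof (induction n)
    case 0
    then show ?case by (simp add: eq)
  next
    case (Suc n)
    show ?case using transfer[OF Suc.IH Suc.prems] by (simp add: DERIV_imp_deriv)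
  qed
  show "(deriv ^^ n) F s = D n s" by (rule val[OF s])
  show "((deriv ^^ n) F has_real_derivative D (Suc n) s) (at s)"
    by (rule transfer[OF val s])
qed

lemma absolutely_monotoneI:
  assumes "\<And>s. s < 0 \<Longrightarrow> F s = D 0 s"
    and "\<And>n s. s < 0 \<Longrightarrow> (D n has_real_derivative D (Suc n) s) (at s)"
    and "\<And>n s. s < 0 \<Longrightarrow> 0 \<le> D n s"
  shows "absolutely_monotone F"
  unfolding absolutely_monotone_def smooth_neg_def field_differentiable_def
proof (intro conjI allI impI)
  fix n and s :: real assume s: "s < 0"
  note H = higher_deriv_neg_eqI[OF assms(1,2) s, of n]
  show "\<exists>f'. ((deriv ^^ n) F has_real_derivative f') (at s)" using H(2) by blast
  show "0 \<le> (deriv ^^ n) F s" using H(1) assms(3)[OF s] by simp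
qed

lemma smooth_neg_higher_deriv:
  assumes "smooth_neg F" "s < 0"
  shows "((deriv ^^ n) F has_real_derivative (deriv ^^ Suc n) F s) (at s)"
  using assms by (simp add: smooth_neg_def DERIV_deriv_iff_field_differentiable)

lemma absolutely_monotone_cong:
  assumes F: "absolutely_monotone F" and "\<And>s. s < 0 \<Longrightarrow> G s = F s"
  shows "absolutely_monotone G"
proof (rule absolutely_monotoneI[where D = "\<lambda>n. (deriv ^^ n) F"])
  show "((deriv ^^ n) F has_real_derivative (deriv ^^ Suc n) F s) (at s)" if "s < 0" for n s
    using F that smooth_neg_higher_deriv unfolding absolutely_monotone_def by blast
  show "0 \<le> (deriv ^^ n) F s" if "s < 0" for n s
    using F that unfolding absolutely_monotone_def by blast
qed (simp add: assms)

lemma absolutely_monotone_mult: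
  assumes F: "absolutely_monotone F" and G: "absolutely_monotone G"
  shows "absolutely_monotone (\<lambda>s. F s * G s)"
proof (rule absolutely_monotoneI
    [where D = "\<lambda>n s. \<Sum>k\<le>n. real (n choose k) * (deriv ^^ k) F s * (deriv ^^ (n - k)) G s"])
  fix n and s :: real assume s: "s < 0"
  let ?f = "\<lambda>k. (deriv ^^ k) F s" and ?g = "\<lambda>k. (deriv ^^ k) G s"
  have sm: "smooth_neg F" "smooth_neg G"
    using F G by (auto simp: absolutely_monotone_def)
  have "((\<lambda>s. \<Sum>k\<le>n. real (n choose k) * (deriv ^^ k) F s * (deriv ^^ (n - k)) G s)
      has_real_derivative
      (\<Sum>k\<le>n. real (n choose k) * (?f (Suc k) * ?g (n - k) + ?f k * ?g (Suc n - k)))) (at s)"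
  proof (rule DERIV_sum)
    fix k assume "k \<in> {..n}"
    then have [simp]: "Suc n - k = Suc (n - k)" by auto
    show "((\<lambda>s. real (n choose k) * (deriv ^^ k) F s * (deriv ^^ (n - k)) G s)
        has_real_derivative
        real (n choose k) * (?f (Suc k) * ?g (n - k) + ?f k * ?g (Suc n - k))) (at s)"
      by (rule DERIV_cong[OF DERIV_mult[OF DERIV_cmult[OF smooth_neg_higher_deriv[OF sm(1) s]]
            smooth_neg_higher_deriv[OF sm(2) s]]]) (simp add: algebra_simps)
  qed
  also have "(\<Sum>k\<le>n. real (n choose k) * (?f (Suc k) * ?g (n - k) + ?f k * ?g (Suc n - k)))
      = (\<Sum>k\<le>n. real (n choose k) * ?f (Suc k) * ?g (n - k))
      + (\<Sum>k\<le>Suc n. real (n choose k) * ?f k * ?g (Suc n - k))"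
    by (simp add: sum.distrib algebra_simps)
  also have "\<dots> = (\<Sum>k\<le>Suc n. real (Suc n choose k) * ?f k * ?g (Suc n - k))"
    by (simp add: sum.atMost_Suc_shift sum.distrib algebra_simps del: sum.atMost_Suc funpow.simps)
  finally show "((\<lambda>s. \<Sum>k\<le>n. real (n choose k) * (deriv ^^ k) F s * (deriv ^^ (n - k)) G s)
      has_real_derivative
      (\<Sum>k\<le>Suc n. real (Suc n choose k) * ?f k * ?g (Suc n - k))) (at s)" .
next
  fix n and s :: real assume "s < 0"
  then show "0 \<le> (\<Sum>k\<le>n. real (n choose k) * (deriv ^^ k) F s * (deriv ^^ (n - k)) G s)"
    using F G by (auto simp: absolutely_monotone_def intro!: sum_nonneg)
qed simp

section \<open>The factor \<open>\<psi>(s) / s\<close>\<close>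

text \<open>The centre \<open>s\<close> of the Taylor polynomial is the variable, and the point of evaluation is
  fixed; this is the combination of derivatives that the Leibniz formula for \<open>\<psi>(s) / s\<close> yields.\<close>

definition taylor_at_0 :: "(real \<Rightarrow> real) \<Rightarrow> nat \<Rightarrow> real \<Rightarrow> real" where
  "taylor_at_0 F n s = (\<Sum>k\<le>n. (deriv ^^ k) F s / fact k * (- s) ^ k)"

text \<open>The sum telescopes: differentiating the derivative of \<open>F\<close> in the term of order \<open>k\<close> gives the
  same as differentiating the power in the term of order \<open>k + 1\<close>, with the opposite sign, so only
  the former survives for \<open>k = n\<close>.\<close>

lemma has_derivative_taylor_at_0:
  assumes "smooth_neg F" "s < 0"
  shows "(taylor_at_0 F n has_real_derivative (deriv ^^ Suc n) F s / fact n * (- s) ^ n) (at s)"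
proof (induction n)
  case 0
  then show ?case
    using smooth_neg_higher_deriv[OF assms, of 0] by (simp add: taylor_at_0_def[abs_def])
next
  case (Suc n)
  have step: "taylor_at_0 F (Suc n)
      = (\<lambda>t. taylor_at_0 F n t + (deriv ^^ Suc n) F t / fact (Suc n) * (- t) ^ Suc n)"
    by (simp add: taylor_at_0_def[abs_def])
  have "((\<lambda>t. (- t) ^ Suc n) has_real_derivative - (real (Suc n) * (- s) ^ n)) (at s)"
    by (rule derivative_eq_intros refl | simp)+
  then have "((\<lambda>t. (deriv ^^ Suc n) F t / fact (Suc n) * (- t) ^ Suc n) has_real_derivative
      (deriv ^^ Suc (Suc n)) F s / fact (Suc n) * (- s) ^ Suc n
      + - (real (Suc n) * (- s) ^ n) * ((deriv ^^ Suc n) F s / fact (Suc n))) (at s)"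
    by (intro DERIV_mult DERIV_cdivide smooth_neg_higher_deriv[OF assms])
  from DERIV_add[OF Suc this] show ?case
    unfolding step by (rule DERIV_cong) (unfold fact_Suc, simp del: funpow.simps of_nat_Suc)
qed

lemma class_T1_higher_deriv_nonneg:
  assumes "\<psi> \<in> class_T1" "s < 0"
  shows "0 \<le> (deriv ^^ Suc n) \<psi> s"
  using assms by (simp add: class_T1_def absolutely_monotone_def funpow_Suc_right del: funpow.simps)

text \<open>The function need not extend to \<open>0\<close>, so Taylor's theorem is applied at a point \<open>e < 0\<close>,
  where the polynomial is \<open>\<psi>(e)\<close> minus a nonnegative remainder, and then \<open>e\<close> tends to \<open>0\<close>.\<close>

lemma taylor_at_0_nonpos:
  assumes psi: "\<psi> \<in> class_T1" and s: "s < 0"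
  shows "taylor_at_0 \<psi> n s \<le> 0"
proof -
  have sm: "smooth_neg \<psi>" and np: "\<And>t. t < 0 \<Longrightarrow> \<psi> t \<le> 0"
    using psi by (auto simp: class_T1_def)
  have "(\<Sum>k\<le>n. (deriv ^^ k) \<psi> s / fact k * (e - s) ^ k) \<le> 0" if e: "s < e" "e < 0" for e
  proof -
    obtain t where t: "s < t" "t < e" and eq:
      "\<psi> e = (\<Sum>m<Suc n. (deriv ^^ m) \<psi> s / fact m * (e - s) ^ m)
         + (deriv ^^ Suc n) \<psi> t / fact (Suc n) * (e - s) ^ Suc n"
      using Taylor_up[of "Suc n" "\<lambda>m. (deriv ^^ m) \<psi>" \<psi> s e s] e
        smooth_neg_higher_deriv[OF sm] by auto
    have "0 \<le> (deriv ^^ Suc n) \<psi> t / fact (Suc n) * (e - s) ^ Suc n"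
      using class_T1_higher_deriv_nonneg[OF psi, of t n] t e
      by (intro mult_nonneg_nonneg divide_nonneg_nonneg zero_le_power) auto
    with eq np[OF e(2)] show ?thesis by (simp add: lessThan_Suc_atMost del: funpow.simps)
  qed
  then have ev: "eventually (\<lambda>e. (\<Sum>k\<le>n. (deriv ^^ k) \<psi> s / fact k * (e - s) ^ k) \<le> 0) (at_left 0)"
    using eventually_at_left_field[of _ "0::real"] s by blast
  have "((\<lambda>e. \<Sum>k\<le>n. (deriv ^^ k) \<psi> s / fact k * (e - s) ^ k) \<longlongrightarrow> taylor_at_0 \<psi> n s) (at_left 0)"
    unfolding taylor_at_0_def by (auto intro!: tendsto_eq_intros)
  from tendsto_upperbound[OF this ev] show ?thesis by simp
qed

lemma absolutely_monotone_div_id: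
  assumes psi: "\<psi> \<in> class_T1"
  shows "absolutely_monotone (\<lambda>s. \<psi> s / s)"
proof (rule absolutely_monotoneI[where D = "\<lambda>n s. - (fact n * taylor_at_0 \<psi> n s) / (- s) ^ Suc n"])
  fix n and s :: real assume s: "s < 0"
  have sm: "smooth_neg \<psi>" using psi by (auto simp: class_T1_def)
  have pw: "((\<lambda>t. (- t) ^ Suc n) has_real_derivative - (real (Suc n) * (- s) ^ n)) (at s)"
    by (rule derivative_eq_intros refl | simp)+
  have next_term: "taylor_at_0 \<psi> (Suc n) s
      = taylor_at_0 \<psi> n s + (deriv ^^ Suc n) \<psi> s / fact (Suc n) * (- s) ^ Suc n"
    by (simp add: taylor_at_0_def)
  (* The quotient rule with f = n!, x = - s, y = (- s) ^ n, a = n + 1, d the derivative of order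
     n + 1 of \<psi>, and g the Taylor polynomial; the left side is the form that DERIV_divide yields. *)
  have quotient: "(- (f * (d / f * y)) * (x * y) - - (f * g) * - (a * y)) / ((x * y) * (x * y))
      = - (a * f * (g + d / (a * f) * (x * y))) / (x * (x * y))"
    if "f > 0" "x > 0" "y > 0" "a > 0" for f d x y g a :: real
    using that by (simp add: divide_simps) (simp add: algebra_simps)
  have pos: "(0::real) < fact n" "0 < - s" "0 < (- s) ^ n" "0 < real (Suc n)"
    using s by auto
  show "((\<lambda>s. - (fact n * taylor_at_0 \<psi> n s) / (- s) ^ Suc n) has_real_derivative
      - (fact (Suc n) * taylor_at_0 \<psi> (Suc n) s) / (- s) ^ Suc (Suc n)) (at s)"
    by (rule DERIV_cong[OF DERIV_divide[OF DERIV_minus[OF DERIV_cmult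
            [OF has_derivative_taylor_at_0[OF sm s]]] pw]])
       (use s quotient[OF pos, of "(deriv ^^ Suc n) \<psi> s" "taylor_at_0 \<psi> n s"] in
         \<open>simp_all only: next_term fact_Suc power_Suc of_nat_mult, simp_all\<close>)
  show "0 \<le> - (fact n * taylor_at_0 \<psi> n s) / (- s) ^ Suc n"
    using taylor_at_0_nonpos[OF psi s, of n] s
    by (intro divide_nonneg_nonneg zero_le_power) (auto simp: mult_le_0_iff)
qed (simp add: taylor_at_0_def)

section \<open>Derivatives of Laplace transforms\<close>

lemma has_real_derivative_quadratic_error:
  fixes F :: "real \<Rightarrow> real"
  assumes d: "0 < d" and bound: "\<And>h. \<bar>h\<bar> \<le> d \<Longrightarrow> \<bar>F (x + h) - F x - h * D\<bar> \<le> C * h\<^sup>2"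
  shows "(F has_real_derivative D) (at x)"
proof -
  have "((\<lambda>h. (F (x + h) - F x) / h - D) \<longlongrightarrow> 0) (at 0)"
  proof (rule Lim_null_comparison)
    show "eventually (\<lambda>h. norm ((F (x + h) - F x) / h - D) \<le> C * \<bar>h\<bar>) (at 0)"
      unfolding eventually_at
    proof (intro exI[of _ d] conjI ballI impI d)
      fix h :: real assume "h \<noteq> 0 \<and> dist h 0 < d"
      then have h: "h \<noteq> 0" "\<bar>h\<bar> \<le> d" by auto
      have "(F (x + h) - F x) / h - D = (F (x + h) - F x - h * D) / h"
        using h(1) by (simp add: field_simps)
      then have "\<bar>(F (x + h) - F x) / h - D\<bar> = \<bar>F (x + h) - F x - h * D\<bar> / \<bar>h\<bar>"
        by simp
      also have "\<dots> \<le> C * h\<^sup>2 / \<bar>h\<bar>"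
        by (intro divide_right_mono bound h) auto
      also have "\<dots> = C * \<bar>h\<bar>"
        using h(1) by (simp add: power2_eq_square abs_if)
      finally show "norm ((F (x + h) - F x) / h - D) \<le> C * \<bar>h\<bar>" by simp
    qed
    show "((\<lambda>h. C * \<bar>h\<bar>) \<longlongrightarrow> 0) (at 0)"
      by (auto intro!: tendsto_eq_intros)
  qed
  then show ?thesis
    unfolding DERIV_def by (simp add: LIM_zero_iff)
qed

text \<open>The \<open>n\<close>-th derivative of the Laplace integral \<open>\<integral> e\<^sup>s\<^sup>r f(r) dr\<close>, written as a function of
  \<open>s = - p < 0\<close>.\<close>

definition laplace_moment :: "(real \<Rightarrow> real) \<Rightarrow> nat \<Rightarrow> real \<Rightarrow> real" where
  "laplace_moment f n s = (LINT r:{0..}|lborel. r ^ n * exp (s * r) * f r)"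

text \<open>Half of the exponential decay absorbs the power \<open>r\<^sup>n\<close>; the other half keeps the integral
  convergent.\<close>

lemma laplace_moment_integrable:
  fixes f :: "real \<Rightarrow> real"
  assumes f: "\<And>p. p > 0 \<Longrightarrow> set_integrable lborel {0..} (\<lambda>r. exp (- p * r) * f r)"
    and s: "s < 0"
  shows "set_integrable lborel {0..} (\<lambda>r. r ^ n * exp (s * r) * f r)"
proof (rule set_integrable_bound)
  define c where "c = - s / 2"
  have c: "c > 0" "s = - 2 * c" using s by (auto simp: c_def)
  show "set_integrable lborel {0..} (\<lambda>r. fact n / c ^ n * (exp (- c * r) * f r))"
    using f[OF c(1)] by (rule set_integrable_mult_right)
  have "(\<lambda>r. r ^ n * exp (- c * r)) \<in> borel_measurable lborel" by measurable
  from borel_measurable_times[OF this borel_measurable_integrable[OF f[OF c(1), unfolded set_integrable_def]]]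
  have "(\<lambda>r. (r ^ n * exp (- c * r)) * (indicator {0..} r *\<^sub>R (exp (- c * r) * f r)))
      \<in> borel_measurable lborel" .
  also have "(\<lambda>r. (r ^ n * exp (- c * r)) * (indicator {0..} r *\<^sub>R (exp (- c * r) * f r)))
      = (\<lambda>r. indicator {0..} r *\<^sub>R (r ^ n * exp (s * r) * f r))"
    by (rule ext) (simp add: c(2) exp_add[symmetric] algebra_simps flip: exp_add)
  finally show "set_borel_measurable lborel {0..} (\<lambda>r. r ^ n * exp (s * r) * f r)"
    unfolding set_borel_measurable_def .
  have "norm (r ^ n * exp (s * r) * f r) \<le> norm (fact n / c ^ n * (exp (- c * r) * f r))"
    if r: "r \<ge> 0" for r
  proof -
    (* one term of the exponential series *)
    have "(c * r) ^ n / fact n \<le> exp (c * r)"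
    proof -
      have "(\<Sum>k\<in>{n}. (c * r) ^ k /\<^sub>R fact k) \<le> (\<Sum>k. (c * r) ^ k /\<^sub>R fact k)"
        using r c(1) by (intro sum_le_suminf summable_exp_generic) auto
      then show ?thesis by (simp add: exp_def field_simps)
    qed
    then have "r ^ n \<le> fact n / c ^ n * exp (c * r)"
      using c(1) by (simp add: power_mult_distrib field_simps)
    then have "r ^ n * exp (s * r) \<le> fact n / c ^ n * exp (c * r) * exp (s * r)"
      by (intro mult_right_mono) auto
    also have "\<dots> = fact n / c ^ n * exp (- c * r)"
      by (simp add: c(2) mult.assoc flip: exp_add)
    finally have "r ^ n * exp (s * r) * \<bar>f r\<bar> \<le> fact n / c ^ n * exp (- c * r) * \<bar>f r\<bar>"
      by (intro mult_right_mono) auto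
    then show ?thesis using r c(1) by (simp add: abs_mult mult.assoc)
  qed
  then show "AE r in lborel. r \<in> {0..} \<longrightarrow>
      norm (r ^ n * exp (s * r) * f r) \<le> norm (fact n / c ^ n * (exp (- c * r) * f r))"
    by auto
qed

lemma exp_minus_linear_bound:
  fixes x :: real
  shows "\<bar>exp x - 1 - x\<bar> \<le> x\<^sup>2 * exp \<bar>x\<bar>"
proof -
  obtain t where t: "\<bar>t\<bar> \<le> \<bar>x\<bar>" "exp x = (\<Sum>m<2. x ^ m / fact m) + exp t / fact 2 * x ^ 2"
    using Maclaurin_exp_le[of x 2] by blast
  have "\<bar>exp x - 1 - x\<bar> = exp t / 2 * x\<^sup>2"
    using t(2) by (simp add: numeral_2_eq_2 abs_mult)
  also have "\<dots> \<le> exp \<bar>x\<bar> * x\<^sup>2"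
  proof (intro mult_right_mono)
    have "exp t \<le> exp \<bar>x\<bar>" using t(1) by simp
    moreover have "0 \<le> exp t" by simp
    ultimately show "exp t / 2 \<le> exp \<bar>x\<bar>" by linarith
  qed simp
  finally show ?thesis by (simp add: mult.commute)
qed

text \<open>For \<open>\<bar>h\<bar> \<le> - s / 2\<close> the second-order error of \<open>e\<^sup>(\<^sup>s\<^sup>+\<^sup>h\<^sup>)\<^sup>r\<close> is at most \<open>h\<^sup>2 r\<^sup>2 e\<^sup>s\<^sup>r\<^sup>/\<^sup>2\<close>, so
  differentiation under the integral sign follows from an explicit bound by the moment of order
  \<open>n + 2\<close> at \<open>s / 2\<close>.\<close>

lemma laplace_moment_has_derivative:
  assumes f: "\<And>p. p > 0 \<Longrightarrow> set_integrable lborel {0..} (\<lambda>r. exp (- p * r) * f r)"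
    and nonneg: "\<And>r. r \<ge> 0 \<Longrightarrow> 0 \<le> f r"
    and s: "s < 0"
  shows "(laplace_moment f n has_real_derivative laplace_moment f (Suc n) s) (at s)"
proof (rule has_real_derivative_quadratic_error)
  show "0 < - s / 2" using s by simp
  fix h assume h: "\<bar>h\<bar> \<le> - s / 2"
  note int = laplace_moment_integrable[OF f]
  have neg: "s + h < 0" "s / 2 < 0" using s h by (auto simp: abs_if split: if_splits)
  let ?E = "\<lambda>r. r ^ n * exp ((s + h) * r) * f r - r ^ n * exp (s * r) * f r
      - h * (r ^ Suc n * exp (s * r) * f r)"
  have intE: "set_integrable lborel {0..} ?E"
    by (intro set_integral_diff set_integrable_mult_right int s neg)
  have eq: "laplace_moment f n (s + h) - laplace_moment f n s - h * laplace_moment f (Suc n) s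
      = (LINT r:{0..}|lborel. ?E r)"
    unfolding laplace_moment_def
    by (simp only: set_integral_diff set_integral_mult_right set_integrable_mult_right int s neg)
  have bound: "\<bar>?E r\<bar> \<le> h\<^sup>2 * (r ^ Suc (Suc n) * exp (s / 2 * r) * f r)" if "r \<in> {0..}" for r
  proof -
    have r: "r \<ge> 0" using that by simp
    have "?E r = r ^ n * exp (s * r) * f r * (exp (h * r) - 1 - h * r)"
      by (simp add: algebra_simps exp_add)
    then have "\<bar>?E r\<bar> = r ^ n * exp (s * r) * f r * \<bar>exp (h * r) - 1 - h * r\<bar>"
      using r nonneg[OF r] by (simp add: abs_mult)
    also have "\<dots> \<le> r ^ n * exp (s * r) * f r * ((h * r)\<^sup>2 * exp \<bar>h * r\<bar>)"
      using r nonneg[OF r] by (intro mult_left_mono exp_minus_linear_bound) auto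
    also have "\<dots> = r ^ n * f r * (h * r)\<^sup>2 * (exp (s * r) * exp (\<bar>h\<bar> * r))"
      using r by (simp add: abs_mult)
    finally have E: "\<bar>?E r\<bar> \<le> r ^ n * f r * (h * r)\<^sup>2 * (exp (s * r) * exp (\<bar>h\<bar> * r))" .
    have le: "exp (s * r) * exp (\<bar>h\<bar> * r) \<le> exp (s / 2 * r)"
      using mult_right_mono[OF h r] by (simp add: algebra_simps flip: exp_add)
    note E
    also have "r ^ n * f r * (h * r)\<^sup>2 * (exp (s * r) * exp (\<bar>h\<bar> * r))
        \<le> r ^ n * f r * (h * r)\<^sup>2 * exp (s / 2 * r)"
      by (rule mult_left_mono[OF le]) (use r nonneg[OF r] in simp)
    also have "\<dots> = h\<^sup>2 * (r ^ Suc (Suc n) * exp (s / 2 * r) * f r)"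
      by (simp add: power2_eq_square)
    finally show ?thesis .
  qed
  have "\<bar>LINT r:{0..}|lborel. ?E r\<bar> \<le> (LINT r:{0..}|lborel. \<bar>?E r\<bar>)"
    using set_integral_norm_bound[OF intE] by simp
  also have "\<dots> \<le> (LINT r:{0..}|lborel. h\<^sup>2 * (r ^ Suc (Suc n) * exp (s / 2 * r) * f r))"
    by (intro set_integral_mono set_integrable_abs intE set_integrable_mult_right int neg bound)
  finally show "\<bar>laplace_moment f n (s + h) - laplace_moment f n s - h * laplace_moment f (Suc n) s\<bar>
      \<le> laplace_moment f (Suc (Suc n)) (s / 2) * h\<^sup>2"
    unfolding eq by (simp add: laplace_moment_def mult.commute)
qed

section \<open>The factor \<open>- s w(s)\<close>\<close>

text \<open>The kernel is the derivative of \<open>- r\<^sup>n e\<^sup>s\<^sup>r\<close>, which vanishes at infinity; for \<open>n = 0\<close> its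
  value at \<open>r = 0\<close> is \<open>- 1\<close>, which is where the \<open>0 ^ n\<close> comes from. In that
  case the truncated exponent \<open>n - 1\<close> is harmless, as its term has the coefficient \<open>0\<close>.\<close>

lemma kernel_integral:
  fixes s :: real
  assumes s: "s < 0"
  defines "k \<equiv> \<lambda>n r. - s * (r ^ n * exp (s * r)) - real n * (r ^ (n - 1) * exp (s * r))"
  shows "set_integrable lborel {0..} (k n)"
    and "(LINT r:{0..}|lborel. k n r) = 0 ^ n"
proof -
  have one: "set_integrable lborel {0..} (\<lambda>r. exp (- p * r) * 1)" if p: "p > 0" for p :: real
  proof -
    have "set_integrable lborel (einterval 0 \<infinity>) (\<lambda>r. exp (- p * r))"
    proof (rule interval_integral_FTC_nonneg)
      show "((\<lambda>r. - exp (- p * r) / p) has_real_derivative exp (- p * x)) (at x)" for x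
        by (rule derivative_eq_intros refl | use p in simp)+
      show "(((\<lambda>r. - exp (- p * r) / p) \<circ> real_of_ereal) \<longlongrightarrow> - 1 / p) (at_right 0)"
        unfolding zero_ereal_def ereal_tendsto_simps using p by (auto intro!: tendsto_eq_intros)
      show "(((\<lambda>r. - exp (- p * r) / p) \<circ> real_of_ereal) \<longlongrightarrow> 0) (at_left \<infinity>)"
        unfolding ereal_tendsto_simps using p by real_asymp
    qed (auto intro!: continuous_intros)
    then have "set_integrable lborel {0<..} (\<lambda>r. exp (- p * r) * 1)"
      by (simp add: zero_ereal_def)
    then show ?thesis
      unfolding set_integrable_def
      by (rule iffD1[OF integrable_discrete_difference[where X = "{0}"], rotated -1])
         (auto split: split_indicator)
  qed
  note int = laplace_moment_integrable[OF one s, simplified]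
  show k: "set_integrable lborel {0..} (k n)"
    unfolding k_def by (intro set_integral_diff set_integrable_mult_right int)
  have "(LBINT r=0..\<infinity>. k n r) = 0 - (- (0 ^ n))"
  proof (rule interval_integral_FTC_integrable)
    show "((\<lambda>r. - (r ^ n * exp (s * r))) has_vector_derivative k n x) (at x)" for x
      unfolding has_real_derivative_iff_has_vector_derivative[symmetric] k_def
      by (rule derivative_eq_intros refl | simp)+
    show "isCont (k n) x" for x unfolding k_def by (intro continuous_intros)
    show "set_integrable lborel (einterval 0 \<infinity>) (k n)"
      by (rule set_integrable_subset[OF k]) (auto simp: zero_ereal_def)
    show "(((\<lambda>r. - (r ^ n * exp (s * r))) \<circ> real_of_ereal) \<longlongrightarrow> - (0 ^ n)) (at_right 0)"
      unfolding zero_ereal_def ereal_tendsto_simps by (auto intro!: tendsto_eq_intros)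
    show "(((\<lambda>r. - (r ^ n * exp (s * r))) \<circ> real_of_ereal) \<longlongrightarrow> 0) (at_left \<infinity>)"
      unfolding ereal_tendsto_simps using s by real_asymp
  qed auto
  moreover have "(LBINT r=0..\<infinity>. k n r) = (LINT r:{0..}|lborel. k n r)"
    unfolding interval_lebesgue_integral_def set_lebesgue_integral_def
    by (simp add: zero_ereal_def)
       (rule integral_discrete_difference[where X = "{0}"], auto split: split_indicator)
  ultimately show "(LINT r:{0..}|lborel. k n r) = 0 ^ n" by simp
qed

text \<open>Both the kernel and \<open>f(r) - f(r\<^sub>0)\<close>, where \<open>r\<^sub>0 = n / (-s)\<close>, are at most \<open>0\<close> before \<open>r\<^sub>0\<close>
  and at least \<open>0\<close> after it, the latter because \<open>f\<close> is nondecreasing. Hence the kernel times this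
  difference is nonnegative, and the integral is at least \<open>f(r\<^sub>0)\<close> times that of the kernel.\<close>

lemma kernel_integral_nonneg:
  fixes s :: real
  assumes f: "\<And>p. p > 0 \<Longrightarrow> set_integrable lborel {0..} (\<lambda>r. exp (- p * r) * f r)"
    and nonneg: "\<And>r. r \<ge> 0 \<Longrightarrow> 0 \<le> f r" and mono: "mono_on {0..} f"
    and s: "s < 0"
  shows "0 \<le> - s * laplace_moment f n s - real n * laplace_moment f (n - 1) s"
proof -
  let ?k = "\<lambda>r. - s * (r ^ n * exp (s * r)) - real n * (r ^ (n - 1) * exp (s * r))"
  define r0 where "r0 = real n / - s"
  have r0: "r0 \<ge> 0" using s by (auto simp: r0_def divide_nonneg_neg)
  note int = laplace_moment_integrable[OF f s]
  have le: "f r0 * ?k r \<le> - s * (r ^ n * exp (s * r) * f r) - real n * (r ^ (n - 1) * exp (s * r) * f r)"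
    if "r \<in> {0..}" for r
  proof -
    have r: "r \<ge> 0" using that by simp
    have "0 \<le> ?k r * (f r - f r0)"
    proof (cases n)
      case 0
      then show ?thesis
        using monotone_onD[OF mono, of r0 r] r s
        by (auto simp: r0_def mult_nonneg_nonneg mult_nonpos_nonneg)
    next
      case (Suc m)
      then have k: "?k r = - s * (r ^ m * exp (s * r)) * (r - r0)"
        using s by (simp add: r0_def field_simps)
      have "0 \<le> (r - r0) * (f r - f r0)"
        using monotone_onD[OF mono, of r r0] monotone_onD[OF mono, of r0 r] r r0
        by (cases "r \<le> r0") (auto intro: mult_nonneg_nonneg mult_nonpos_nonpos)
      moreover have "0 \<le> - s * (r ^ m * exp (s * r))"
        using s r by (intro mult_nonneg_nonneg) auto
      ultimately have "0 \<le> - s * (r ^ m * exp (s * r)) * ((r - r0) * (f r - f r0))"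
        by (rule mult_nonneg_nonneg[rotated])
      then show ?thesis unfolding k by (simp only: mult.assoc)
    qed
    then show ?thesis by (simp add: algebra_simps)
  qed
  have "0 \<le> f r0 * 0 ^ n" using nonneg[OF r0] by simp
  also have "\<dots> = (LINT r:{0..}|lborel. f r0 * ?k r)"
    using kernel_integral(2)[OF s, of n] by simp
  also have "\<dots> \<le> (LINT r:{0..}|lborel.
      - s * (r ^ n * exp (s * r) * f r) - real n * (r ^ (n - 1) * exp (s * r) * f r))"
    by (intro set_integral_mono set_integrable_mult_right[OF kernel_integral(1)[OF s]]
        set_integral_diff set_integrable_mult_right int le)
  also have "\<dots> = - s * laplace_moment f n s - real n * laplace_moment f (n - 1) s"
    unfolding laplace_moment_def
    by (simp only: set_integral_diff set_integral_mult_right set_integrable_mult_right int)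
  finally show ?thesis .
qed

lemma absolutely_monotone_id_times_laplace:
  assumes f: "\<And>p. p > 0 \<Longrightarrow> set_integrable lborel {0..} (\<lambda>r. exp (- p * r) * f r)"
    and nonneg: "\<And>r. r \<ge> 0 \<Longrightarrow> 0 \<le> f r" and mono: "mono_on {0..} f"
  shows "absolutely_monotone (\<lambda>s. - s * laplace_moment f 0 s)"
proof (rule absolutely_monotoneI
    [where D = "\<lambda>n s. - s * laplace_moment f n s - real n * laplace_moment f (n - 1) s"])
  fix n and s :: real assume s: "s < 0"
  note M = laplace_moment_has_derivative[OF f nonneg s]
  have "((\<lambda>s. real n * laplace_moment f (n - 1) s) has_real_derivative
      real n * laplace_moment f n s) (at s)"
    using DERIV_cmult[OF M[of "n - 1"], of "real n"] by (cases n) auto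
  from DERIV_diff[OF DERIV_mult[OF DERIV_minus[OF DERIV_ident] M[of n]] this]
  have "((\<lambda>s. - s * laplace_moment f n s - real n * laplace_moment f (n - 1) s)
      has_real_derivative
      - 1 * laplace_moment f n s + laplace_moment f (Suc n) s * - s
        - real n * laplace_moment f n s) (at s)" .
  moreover have "- 1 * laplace_moment f n s + laplace_moment f (Suc n) s * - s
        - real n * laplace_moment f n s
      = - s * laplace_moment f (Suc n) s - real (Suc n) * laplace_moment f (Suc n - 1) s"
    by (simp add: algebra_simps)
  ultimately show "((\<lambda>s. - s * laplace_moment f n s - real n * laplace_moment f (n - 1) s)
      has_real_derivative
      - s * laplace_moment f (Suc n) s - real (Suc n) * laplace_moment f (Suc n - 1) s) (at s)"
    by (rule DERIV_cong)
  show "0 \<le> - s * laplace_moment f n s - real n * laplace_moment f (n - 1) s"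
    by (rule kernel_integral_nonneg[OF f nonneg mono s])
qed simp

section \<open>The integral function\<close>

text \<open>The integrand may be singular at \<open>0\<close>, so the integral is split: near \<open>s\<close>, the integral from
  \<open>u\<close> to \<open>0\<close> is a constant minus the integral from \<open>a = 2 s\<close> to \<open>u\<close>, and on \<open>[a, b]\<close> with
  \<open>b = s / 2 < 0\<close> the integrand is continuous.\<close>

lemma integral_to_0_has_derivative:
  fixes g :: "real \<Rightarrow> real"
  assumes int: "\<And>s. s < 0 \<Longrightarrow> set_integrable lborel {s<..<0} g"
    and cont: "continuous_on {..<0} g" and s: "s < 0"
  shows "((\<lambda>s. LINT t:{s<..<0}|lborel. g t) has_real_derivative - g s) (at s)"
proof -
  define a b where "a = 2 * s" and "b = s / 2"
  have ab: "a < s" "s < b" "b < 0" using s by (auto simp: a_def b_def)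
  let ?I = "\<lambda>u. LBINT t=a..u. g t"
  have "(?I has_vector_derivative g s) (at s within {a..b})"
    by (rule interval_integral_FTC2) (use ab in \<open>auto intro: continuous_on_subset[OF cont]\<close>)
  then have "(?I has_real_derivative g s) (at s)"
    using ab by (simp add: at_within_Icc_at has_real_derivative_iff_has_vector_derivative)
  from DERIV_diff[OF DERIV_const this, of "LINT t:{a<..<0}|lborel. g t"]
  have "((\<lambda>u. (LINT t:{a<..<0}|lborel. g t) - ?I u) has_real_derivative - g s) (at s)" by simp
  then show ?thesis
  proof (rule has_field_derivative_transform_within_open[where S = "{a<..<0}"])
    fix u assume u: "u \<in> {a<..<0}"
    have "(LBINT t=a..u. g t) + (LBINT t=u..0. g t) = (LBINT t=a..0. g t)"
      using u int[of a] ab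
      by (intro interval_integral_sum) (auto simp: interval_lebesgue_integrable_def zero_ereal_def)
    then show "(LINT t:{a<..<0}|lborel. g t) - ?I u = (LINT t:{u<..<0}|lborel. g t)"
      using u ab by (auto simp: interval_lebesgue_integral_def zero_ereal_def)
  qed (use ab in auto)
qed

theorem mainTheorem4:
  fixes w \<psi> \<phi> :: "real \<Rightarrow> real"
  assumes w: "\<exists>f. nonneg_nondecreasing_original f \<and> has_laplace_transform f (\<lambda>p. w (- p))"
    and psi: "\<psi> \<in> class_T1"
    and psi'_lim: "(deriv \<psi> \<longlongrightarrow> 0) at_bot"
    and integral_exists: "\<And>s. s < 0 \<Longrightarrow> set_integrable lborel {s<..<0} (\<lambda>t. \<psi> t * w t)"
    and phi: "\<And>s. s < 0 \<Longrightarrow> \<phi> s = (LINT t:{s<..<0}|lborel. \<psi> t * w t)"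
  shows "\<phi> \<in> class_T1"
proof -
  obtain f where f: "nonneg_nondecreasing_original f"
    and lap: "has_laplace_transform f (\<lambda>p. w (- p))"
    using w by blast
  have f_int: "\<And>p. p > 0 \<Longrightarrow> set_integrable lborel {0..} (\<lambda>r. exp (- p * r) * f r)"
    using lap by (simp add: has_laplace_transform_def)
  have f_nonneg: "\<And>r. r \<ge> 0 \<Longrightarrow> 0 \<le> f r" and f_mono: "mono_on {0..} f"
    using f by (auto simp: nonneg_nondecreasing_original_def)
  have w_eq: "w s = laplace_moment f 0 s" if "s < 0" for s
    using lap that unfolding has_laplace_transform_def laplace_moment_def
    by (auto dest: spec[of _ "- s"])
  have psi_w: "absolutely_monotone (\<lambda>s. - (\<psi> s * w s))"
    by (rule absolutely_monotone_cong[OF absolutely_monotone_mult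
          [OF absolutely_monotone_div_id[OF psi]
            absolutely_monotone_id_times_laplace[OF f_int f_nonneg f_mono]]])
       (simp_all add: w_eq)
  have psi_w_le: "\<psi> t * w t \<le> 0" if "t < 0" for t
    using psi_w that unfolding absolutely_monotone_def by (auto dest!: spec[of _ "0::nat"])
  have "(\<lambda>s. - (\<psi> s * w s)) field_differentiable at t" if "t < 0" for t
    using psi_w that unfolding absolutely_monotone_def smooth_neg_def
    by (auto dest!: spec[of _ "0::nat"])
  then have "continuous_on {..<0} (\<lambda>s. - (- (\<psi> s * w s)))"
    by (intro continuous_on_minus continuous_at_imp_continuous_on)
       (auto intro: field_differentiable_imp_continuous_at)
  then have cont: "continuous_on {..<0} (\<lambda>s. \<psi> s * w s)" by simp
  have phi_deriv: "(\<phi> has_real_derivative - (\<psi> s * w s)) (at s)" if "s < 0" for s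
    by (rule has_field_derivative_transform_within_open
        [OF integral_to_0_has_derivative[OF integral_exists cont that], where S = "{..<0}"])
       (use that in \<open>auto simp: phi\<close>)
  have am: "absolutely_monotone (deriv \<phi>)"
    by (rule absolutely_monotone_cong[OF psi_w]) (use phi_deriv in \<open>auto intro: DERIV_imp_deriv\<close>)
  have "smooth_neg \<phi>"
    unfolding smooth_neg_def
  proof (intro allI impI)
    fix n and s :: real assume s: "s < 0"
    show "(deriv ^^ n) \<phi> field_differentiable at s"
    proof (cases n)
      case 0
      then show ?thesis using phi_deriv[OF s] by (auto simp: field_differentiable_def)
    next
      case (Suc m)
      then show ?thesis
        using am s unfolding absolutely_monotone_def smooth_neg_def
        by (simp add: funpow_Suc_right del: funpow.simps)
    qed
  qed
  moreover have "\<phi> s \<le> 0" if "s < 0" for s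
  proof -
    have "(LINT t:{s<..<0}|lborel. \<psi> t * w t) \<le> (LINT t:{s<..<0}|lborel. 0)"
      by (rule set_integral_mono[OF integral_exists[OF that]])
         (use psi_w_le in \<open>auto simp: set_integrable_def\<close>)
    then show ?thesis using phi[OF that] by (simp add: set_lebesgue_integral_def)
  qed
  ultimately show ?thesis using am by (simp add: class_T1_def)
qed

end
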